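(* Let $d\ge 1$ and $L\ge 0$ be integers, and suppose that $g\colon\{0,1\}^L\to\{0,1\}$ is a function of degree at most $d$ depending on all of its $L$ coordinates. Then for all integers $n,k$ satisfying $L \leq k \leq n-L$ there exists a function $f\colon \binom{[n]}{k}\to\{0,1\}$ of degree at most $d$ which is an $L$-junta but not an $(L-1)$-junta.
   Context: Write $[n]=\{1,\ldots,n\}$. For $0\le k\le n$, the slice $\binom{[n]}{k}$ is the set of all $x\in\{0,1\}^n$ with $\sum_{i=1}^n x_i=k$. The degree of a function on the slice (respectively on the hypercube $\{0,1\}^L$) is the minimum degree of a real polynomial in the coordinates that agrees with the function on all points of the slice (respectively of the hypercube). A function $f$ on the slice is an $m$-junta if there is a set $I\subseteq[n]$ with $|I|\le m$ such that $f(x)=h(x|_I)$ for some function $h\colon\{0,1\}^I\to\{0,1\}$, where $x|_I=(x_i)_{i\in I}$. A function on the hypercube depends on coordinate $i$ if there are two points differing only in coordinate $i$ on which it takes different values. *)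

theory Defs
  imports Complex_Main "HOL-Library.FuncSet" "HOL-Library.Poly_Mapping"
begin

text \<open>
  A real polynomial in variables indexed by \<^typ>\<open>nat\<close> is a finitely supported map from
  monomials (finitely supported exponent maps) to real coefficients.
\<close>

type_synonym real_mpoly = "(nat \<Rightarrow>\<^sub>0 nat) \<Rightarrow>\<^sub>0 real"

definition mpoly_vars :: "real_mpoly \<Rightarrow> nat set" where
  "mpoly_vars p = (\<Union>m\<in>Poly_Mapping.keys p. Poly_Mapping.keys m)"

definition mpoly_eval :: "real_mpoly \<Rightarrow> (nat \<Rightarrow> real) \<Rightarrow> real" where
  "mpoly_eval p x =
     (\<Sum>m\<in>Poly_Mapping.keys p. Poly_Mapping.lookup p m *
        (\<Prod>i\<in>Poly_Mapping.keys m. x i ^ Poly_Mapping.lookup m i))"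

definition monom_degree :: "(nat \<Rightarrow>\<^sub>0 nat) \<Rightarrow> nat" where
  "monom_degree m = (\<Sum>i\<in>Poly_Mapping.keys m. Poly_Mapping.lookup m i)"

text \<open>The zero polynomial is given total degree 0.\<close>

definition mpoly_degree :: "real_mpoly \<Rightarrow> nat" where
  "mpoly_degree p = Max (insert 0 (monom_degree ` Poly_Mapping.keys p))"

text \<open>
  Points of \<open>{0,1}\<^sup>I\<close> are extensional functions, so that they are determined by their
  coordinates in \<open>I\<close>. Coordinates are real numbers, so that polynomials can be evaluated
  at them directly.
\<close>

definition cube_on :: "nat set \<Rightarrow> (nat \<Rightarrow> real) set" where
  "cube_on I = I \<rightarrow>\<^sub>E {0, 1}"

abbreviation cube :: "nat \<Rightarrow> (nat \<Rightarrow> real) set" where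
  "cube n \<equiv> cube_on {1..n}"

definition slice :: "nat \<Rightarrow> nat \<Rightarrow> (nat \<Rightarrow> real) set" where
  "slice n k = {x \<in> cube n. (\<Sum>i=1..n. x i) = real k}"

text \<open>
  The degree of a function on \<open>S \<subseteq> {0,1}\<^sup>n\<close>. Every function on such a set agrees on it with
  some polynomial (by interpolation), so the minimum is over a nonempty set. Values of \<open>f\<close>
  outside \<open>S\<close> play no role.
\<close>

definition degree_on :: "nat \<Rightarrow> (nat \<Rightarrow> real) set \<Rightarrow> ((nat \<Rightarrow> real) \<Rightarrow> real) \<Rightarrow> nat" where
  "degree_on n S f =
     (LEAST d. \<exists>p. mpoly_vars p \<subseteq> {1..n} \<and> mpoly_degree p = d \<and> (\<forall>x\<in>S. mpoly_eval p x = f x))"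

text \<open>
  The bound \<open>m\<close> is an integer so that \<open>L - 1\<close> is not truncated at \<open>L = 0\<close>; no function is
  an \<open>m\<close>-junta for negative \<open>m\<close>.
\<close>

definition slice_junta :: "nat \<Rightarrow> nat \<Rightarrow> int \<Rightarrow> ((nat \<Rightarrow> real) \<Rightarrow> real) \<Rightarrow> bool" where
  "slice_junta n k m f \<longleftrightarrow>
     (\<exists>I\<subseteq>{1..n}. int (card I) \<le> m \<and>
        (\<exists>h \<in> cube_on I \<rightarrow> {0, 1}. \<forall>x\<in>slice n k. f x = h (restrict x I)))"

definition cube_depends_on :: "nat \<Rightarrow> ((nat \<Rightarrow> real) \<Rightarrow> real) \<Rightarrow> nat \<Rightarrow> bool" where
  "cube_depends_on L g i \<longleftrightarrow>
     (\<exists>x\<in>cube L. \<exists>y\<in>cube L. x i \<noteq> y i \<and> (\<forall>j\<in>{1..L} - {i}. x j = y j) \<and> g x \<noteq> g y)"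

end

theory Submission
  imports Defs
begin

text \<open>
  Take \<open>f x = g (x\<^sub>1, \<dots>, x\<^sub>L)\<close>. If \<open>f\<close> only depended on a set \<open>I\<close> of fewer than \<open>L\<close>
  coordinates, pick \<open>i \<le> L\<close> outside \<open>I\<close> and two points of \<open>{0,1}\<^sup>L\<close> differing only at \<open>i\<close> that
  \<open>g\<close> separates. Since \<open>n - L \<ge> L > card I\<close>, there is also \<open>j > L\<close> outside \<open>I\<close>; both points
  extend to the slice with \<open>x\<^sub>j = 1 - x\<^sub>i\<close> and the same values at all other coordinates, and
  so agree on \<open>I\<close>.
\<close>

lemma mem_cube_on_iff:
  "x \<in> cube_on A \<longleftrightarrow> (\<forall>i\<in>A. x i = 0 \<or> x i = 1) \<and> (\<forall>i. i \<notin> A \<longrightarrow> x i = undefined)"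
  by (auto simp: cube_on_def PiE_iff extensional_def)

lemma restrict_mem_cube_on:
  assumes "x \<in> cube_on B" "A \<subseteq> B"
  shows "restrict x A \<in> cube_on A"
  using assms by (auto simp: mem_cube_on_iff)

text \<open>Induction on the coordinates: since \<open>x a\<close> is 0 or 1, \<open>g\<close> at
  \<open>x\<close> is the value at \<open>a := 0\<close> plus \<open>x a\<close> times the
  difference of the values at \<open>a := 1\<close> and \<open>a := 0\<close>. The hypothesis is
  applied to both of these restrictions of \<open>g\<close>, hence
  \<open>arbitrary: g\<close>.\<close>

lemma cube_on_multilinear:
  assumes "finite A"
  shows "\<exists>c. \<forall>x\<in>cube_on A. g x = (\<Sum>S\<in>Pow A. c S * (\<Prod>i\<in>S. x i))"
  using assms
proof (induction A arbitrary: g rule: finite_induct)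
  case empty
  \<comment> \<open>The only point of \<open>cube_on {}\<close> is the everywhere
    \<open>undefined\<close> function, so the constant term is the value there.\<close>
  then show ?case
    by (intro exI[of _ "\<lambda>_. g (\<lambda>_. undefined)"]) (auto simp: cube_on_def)
next
  case (insert a A)
  from insert.IH[of "\<lambda>y. g (y(a := 0))"] obtain c0 where
    c0: "\<And>x. x \<in> cube_on A \<Longrightarrow> g (x(a := 0)) = (\<Sum>S\<in>Pow A. c0 S * (\<Prod>i\<in>S. x i))" by blast
  from insert.IH[of "\<lambda>y. g (y(a := 1))"] obtain c1 where
    c1: "\<And>x. x \<in> cube_on A \<Longrightarrow> g (x(a := 1)) = (\<Sum>S\<in>Pow A. c1 S * (\<Prod>i\<in>S. x i))" by blast
  \<comment> \<open>Expanding the formula above, a set without \<open>a\<close> keeps its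
    coefficient from \<open>c0\<close>, and a set containing \<open>a\<close> gets the difference of
    the two coefficients of its remainder.\<close>
  define c where "c S = (if a \<in> S then c1 (S - {a}) - c0 (S - {a}) else c0 S)" for S
  have "g x = (\<Sum>S\<in>Pow (insert a A). c S * (\<Prod>i\<in>S. x i))" if x: "x \<in> cube_on (insert a A)" for x
  proof -
    define y where "y = restrict x A"
    have y: "y \<in> cube_on A"
      unfolding y_def using x by (rule restrict_mem_cube_on) blast
    have xa: "x a = 0 \<or> x a = 1" and xy: "x = y(a := x a)"
      using x insert.hyps by (auto simp: y_def mem_cube_on_iff)
    have prod: "(\<Prod>i\<in>S. x i) = (\<Prod>i\<in>S. y i)" if "S \<subseteq> A" for S
      using that by (intro prod.cong) (auto simp: y_def)
    have "inj_on (insert a) (Pow A)"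
      using insert.hyps by (auto simp: inj_on_def)
    moreover have "Pow A \<inter> insert a ` Pow A = {}"
      using insert.hyps by auto
    ultimately have "(\<Sum>S\<in>Pow (insert a A). c S * (\<Prod>i\<in>S. x i))
        = (\<Sum>S\<in>Pow A. c S * (\<Prod>i\<in>S. x i))
          + (\<Sum>S\<in>Pow A. c (insert a S) * (\<Prod>i\<in>insert a S. x i))"
      using insert.hyps by (simp add: Pow_insert sum.union_disjoint sum.reindex)
    also have "(\<Sum>S\<in>Pow A. c S * (\<Prod>i\<in>S. x i)) = (\<Sum>S\<in>Pow A. c0 S * (\<Prod>i\<in>S. y i))"
      using insert.hyps by (intro sum.cong refl) (auto simp: c_def prod)
    also have "(\<Sum>S\<in>Pow A. c (insert a S) * (\<Prod>i\<in>insert a S. x i))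
        = (\<Sum>S\<in>Pow A. x a * (c1 S * (\<Prod>i\<in>S. y i) - c0 S * (\<Prod>i\<in>S. y i)))"
    proof (intro sum.cong refl)
      fix S assume "S \<in> Pow A"
      then have "S \<subseteq> A" "a \<notin> S" "finite S"
        using insert.hyps by (auto intro: finite_subset)
      then show "c (insert a S) * (\<Prod>i\<in>insert a S. x i)
          = x a * (c1 S * (\<Prod>i\<in>S. y i) - c0 S * (\<Prod>i\<in>S. y i))"
        by (simp add: c_def prod algebra_simps)
    qed
    also have "\<dots> = x a * (g (y(a := 1)) - g (y(a := 0)))"
      by (simp add: c0[OF y] c1[OF y] flip: sum_distrib_left sum_subtractf)
    also have "(\<Sum>S\<in>Pow A. c0 S * (\<Prod>i\<in>S. y i)) = g (y(a := 0))"
      by (simp add: c0[OF y])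
    finally have "(\<Sum>S\<in>Pow (insert a A). c S * (\<Prod>i\<in>S. x i))
        = g (y(a := 0)) + x a * (g (y(a := 1)) - g (y(a := 0)))" .
    \<comment> \<open>For either value of \<open>x a\<close> the right-hand side collapses to
      \<open>g (y(a := x a))\<close>, which is \<open>g x\<close>.\<close>
    with xa show ?thesis
      by (subst xy) auto
  qed
  then show ?case by blast
qed

text \<open>The squarefree monomial with variable set \<open>S\<close>. It is meaningful only for
  finite \<open>S\<close>, as exponent maps have finite support.\<close>

definition set_monom :: "nat set \<Rightarrow> (nat \<Rightarrow>\<^sub>0 nat)" where
  "set_monom S = Poly_Mapping.Abs_poly_mapping (\<lambda>i. if i \<in> S then 1 else 0)"

lemma lookup_set_monom:
  "finite S \<Longrightarrow> Poly_Mapping.lookup (set_monom S) i = (if i \<in> S then 1 else 0)"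
  by (simp add: set_monom_def Poly_Mapping.Abs_poly_mapping_inverse)

lemma keys_set_monom: "finite S \<Longrightarrow> Poly_Mapping.keys (set_monom S) = S"
  by (auto simp: in_keys_iff lookup_set_monom split: if_splits)

text \<open>This turns the multilinear expansion into a formal polynomial. The index set of a
  coefficient is read back from its monomial, as \<open>keys\<close> inverts
  \<open>set_monom\<close> on finite sets.\<close>

lemma mpoly_interpolate_cube_on:
  assumes "finite A"
  shows "\<exists>p. mpoly_vars p \<subseteq> A \<and> (\<forall>x\<in>cube_on A. mpoly_eval p x = g x)"
proof -
  obtain c where c: "\<And>x. x \<in> cube_on A \<Longrightarrow> g x = (\<Sum>S\<in>Pow A. c S * (\<Prod>i\<in>S. x i))"
    using cube_on_multilinear[OF assms] by blast
  define M where "M = set_monom ` Pow A"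
  define p :: real_mpoly where
    "p = Poly_Mapping.Abs_poly_mapping (\<lambda>m. if m \<in> M then c (Poly_Mapping.keys m) else 0)"
  have fin: "finite S" if "S \<in> Pow A" for S
    using that assms by (auto intro: finite_subset)
  have "finite M"
    using assms by (simp add: M_def)
  then have lookup: "Poly_Mapping.lookup p m = (if m \<in> M then c (Poly_Mapping.keys m) else 0)" for m
    by (simp add: p_def Poly_Mapping.Abs_poly_mapping_inverse)
  then have keys: "Poly_Mapping.keys p \<subseteq> M"
    by (auto simp: in_keys_iff split: if_splits)
  have inj: "inj_on set_monom (Pow A)"
    by (metis inj_onI keys_set_monom fin)
  have "mpoly_eval p x = g x" if "x \<in> cube_on A" for x
  proof -
    \<comment> \<open>Some coefficients may vanish, so \<open>keys p\<close> can be smaller than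
      \<open>M\<close>; the extra terms are zero.\<close>
    have "mpoly_eval p x = (\<Sum>m\<in>M. Poly_Mapping.lookup p m *
        (\<Prod>i\<in>Poly_Mapping.keys m. x i ^ Poly_Mapping.lookup m i))"
      unfolding mpoly_eval_def using \<open>finite M\<close> keys
      by (intro sum.mono_neutral_left) (auto simp: in_keys_iff)
    also have "\<dots> = (\<Sum>S\<in>Pow A. c S * (\<Prod>i\<in>S. x i))"
      unfolding M_def sum.reindex[OF inj]
      by (intro sum.cong refl)
        (simp add: lookup M_def keys_set_monom lookup_set_monom fin)
    finally show ?thesis using c[OF that] by simp
  qed
  moreover have "mpoly_vars p \<subseteq> A"
    unfolding mpoly_vars_def using keys by (fastforce simp: M_def keys_set_monom fin)
  ultimately show ?thesis by blast
qed

text \<open>A \<open>LEAST\<close> carries information only if its predicate is satisfiable;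
  interpolation supplies the witness.\<close>

lemma degree_on_cube_attained:
  "\<exists>p. mpoly_vars p \<subseteq> {1..L} \<and> mpoly_degree p = degree_on L (cube L) g
     \<and> (\<forall>x\<in>cube L. mpoly_eval p x = g x)"
  unfolding degree_on_def
  by (rule LeastI_ex) (use mpoly_interpolate_cube_on[of "{1..L}" g] in blast)

lemma mpoly_eval_cong:
  assumes "\<And>i. i \<in> mpoly_vars p \<Longrightarrow> x i = y i"
  shows "mpoly_eval p x = mpoly_eval p y"
proof -
  have "(\<Prod>i\<in>Poly_Mapping.keys m. x i ^ Poly_Mapping.lookup m i)
      = (\<Prod>i\<in>Poly_Mapping.keys m. y i ^ Poly_Mapping.lookup m i)"
    if "m \<in> Poly_Mapping.keys p" for m
  proof (intro prod.cong refl)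
    fix i assume "i \<in> Poly_Mapping.keys m"
    then have "x i = y i"
      using that by (intro assms) (auto simp: mpoly_vars_def)
    then show "x i ^ Poly_Mapping.lookup m i = y i ^ Poly_Mapping.lookup m i" by simp
  qed
  then show ?thesis by (simp add: mpoly_eval_def)
qed

lemma slice_restrict_cube:
  assumes "x \<in> slice n k" "L \<le> n"
  shows "restrict x {1..L} \<in> cube L"
  using assms by (intro restrict_mem_cube_on[of x "{1..n}"]) (auto simp: slice_def)

text \<open>A polynomial of minimum degree for \<open>g\<close> reads only the first
  \<open>L\<close> coordinates, so it also represents the lifted function. Only an inequality holds
  in general: for \<open>k = 0\<close> the slice is one point and the degree drops to 0.\<close>

lemma degree_on_slice_lift:
  assumes "L \<le> n"
  shows "degree_on n (slice n k) (\<lambda>x. g (restrict x {1..L})) \<le> degree_on L (cube L) g"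
proof -
  obtain p where p: "mpoly_vars p \<subseteq> {1..L}" "mpoly_degree p = degree_on L (cube L) g"
    "\<And>x. x \<in> cube L \<Longrightarrow> mpoly_eval p x = g x"
    using degree_on_cube_attained by blast
  have "mpoly_eval p x = g (restrict x {1..L})" if "x \<in> slice n k" for x
  proof -
    have "mpoly_eval p x = mpoly_eval p (restrict x {1..L})"
      using p(1) by (intro mpoly_eval_cong) auto
    then show ?thesis
      using p(3) slice_restrict_cube[OF that assms] by simp
  qed
  moreover have "mpoly_vars p \<subseteq> {1..n}"
    using p(1) assms by fastforce
  ultimately show ?thesis
    unfolding degree_on_def[of n] using p(2) by (intro Least_le) blast
qed

text \<open>Coordinates \<open>i\<close> and \<open>j\<close> together contribute 1 to the weight,
  whatever \<open>x i\<close> is. So one padding set \<open>T\<close> of further ones serves both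
  points that differ at \<open>i\<close>.\<close>

definition slice_extend ::
    "nat \<Rightarrow> nat \<Rightarrow> nat \<Rightarrow> nat \<Rightarrow> nat set \<Rightarrow> (nat \<Rightarrow> real) \<Rightarrow> nat \<Rightarrow> real" where
  "slice_extend n L i j T x = (\<lambda>m\<in>{1..n}. if m \<le> L then x m
     else if m = j then 1 - x i else if m \<in> T then 1 else 0)"

lemma slice_extend_mem_slice:
  assumes x: "x \<in> cube L" and i: "i \<in> {1..L}" and j: "j \<in> {L<..n}" and T: "T \<subseteq> {L<..n} - {j}"
    and total: "(\<Sum>m\<in>{1..L} - {i}. x m) + 1 + real (card T) = real k"
  shows "slice_extend n L i j T x \<in> slice n k"
proof -
  let ?X = "slice_extend n L i j T x"
  have "{1..n} = {1..L} \<union> {L<..n}" using j by auto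
  then have "sum ?X {1..n} = sum ?X {1..L} + sum ?X {L<..n}"
    by (simp only:) (intro sum.union_disjoint, auto)
  also have "sum ?X {1..L} = (\<Sum>m\<in>{1..L}. x m)"
    using j by (intro sum.cong) (auto simp: slice_extend_def)
  also have "\<dots> = x i + (\<Sum>m\<in>{1..L} - {i}. x m)"
    using i by (simp add: sum.remove)
  also have "sum ?X {L<..n} = ?X j + sum ?X ({L<..n} - {j})"
    using j by (simp add: sum.remove)
  also have "?X j = 1 - x i"
    using j by (auto simp: slice_extend_def)
  also have "sum ?X ({L<..n} - {j}) = (\<Sum>m\<in>{L<..n} - {j}. if m \<in> T then 1 else 0)"
    by (intro sum.cong) (auto simp: slice_extend_def)
  also have "\<dots> = real (card T)"
    using T by (simp add: sum.If_cases Int_absorb1)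
  finally have "sum ?X {1..n} = real k"
    using total by simp
  moreover have "?X \<in> cube n"
    using x i by (auto simp: mem_cube_on_iff slice_extend_def)
  ultimately show ?thesis by (simp add: slice_def)
qed

text \<open>Equality holds outside \<open>{1..L}\<close> as well: points of \<open>cube L\<close>
  are \<open>undefined\<close> there, and so is the restriction.\<close>

lemma restrict_slice_extend:
  assumes "x \<in> cube L" "L \<le> n"
  shows "restrict (slice_extend n L i j T x) {1..L} = x"
  using assms by (auto simp: slice_extend_def mem_cube_on_iff fun_eq_iff)

lemma sum_01_eq_card:
  assumes "finite A" "\<And>m. m \<in> A \<Longrightarrow> x m = (0::real) \<or> x m = 1"
  shows "sum x A = real (card {m \<in> A. x m = 1})"
proof -
  have "sum x A = (\<Sum>m\<in>A. if x m = 1 then 1 else 0)"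
    using assms by (intro sum.cong) auto
  then show ?thesis
    using assms by (simp add: sum.If_cases Int_def)
qed

lemma not_slice_junta_lift:
  assumes dep: "\<forall>i\<in>{1..L}. cube_depends_on L g i" and Lk: "L \<le> k" and kn: "k + L \<le> n"
  shows "\<not> slice_junta n k (int L - 1) (\<lambda>x. g (restrict x {1..L}))"
proof
  assume "slice_junta n k (int L - 1) (\<lambda>x. g (restrict x {1..L}))"
  then obtain I h where I: "I \<subseteq> {1..n}" "int (card I) \<le> int L - 1"
    and h: "\<And>x. x \<in> slice n k \<Longrightarrow> g (restrict x {1..L}) = h (restrict x I)"
    unfolding slice_junta_def by blast
  have "finite I" using I(1) finite_subset by blast
  \<comment> \<open>Pigeonhole, used for the first \<open>L\<close> coordinates and for the
    remaining \<open>n - L\<close>, of which there are at least \<open>k \<ge> L\<close>. For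
    \<open>L = 0\<close> the integer bound on \<open>card I\<close> is already
    contradictory.\<close>
  have escape: "\<exists>i\<in>A. i \<notin> I" if "L \<le> card A" for A
  proof (rule ccontr)
    assume "\<not> ?thesis"
    then have "card A \<le> card I"
      by (intro card_mono \<open>finite I\<close>) blast
    with that I(2) show False by linarith
  qed
  from escape[of "{1..L}"] obtain i where i: "i \<in> {1..L}" "i \<notin> I" by auto
  from escape[of "{L<..n}"] obtain j where j: "j \<in> {L<..n}" "j \<notin> I"
    using Lk kn by fastforce
  obtain x y where x: "x \<in> cube L" and y: "y \<in> cube L"
    and xy: "\<And>m. m \<in> {1..L} - {i} \<Longrightarrow> x m = y m" and g: "g x \<noteq> g y"
    using dep i(1) unfolding cube_depends_on_def by blast
  \<comment> \<open>The weight that \<open>x\<close> and \<open>y\<close> share away from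
    \<open>i\<close>.\<close>
  define t where "t = card {m \<in> {1..L} - {i}. x m = 1}"
  have sum_x: "(\<Sum>m\<in>{1..L} - {i}. x m) = real t"
    unfolding t_def using x by (intro sum_01_eq_card) (auto simp: mem_cube_on_iff)
  have sum_y: "(\<Sum>m\<in>{1..L} - {i}. y m) = real t"
    using xy sum_x by (metis (no_types, lifting) sum.cong)
  have "t \<le> card ({1..L} - {i})"
    unfolding t_def by (intro card_mono) auto
  then have t: "t + 1 \<le> L" using i(1) by auto
  \<comment> \<open>The weight still missing. The subtraction is not truncated, as
    \<open>t + 1 \<le> L \<le> k\<close>, and there is room for it, as
    \<open>n - L - 1 \<ge> k - 1\<close>.\<close>
  have "k - 1 - t \<le> card ({L<..n} - {j})"
    using j(1) kn t by (simp add: card_Diff_singleton)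
  then obtain T where T: "T \<subseteq> {L<..n} - {j}" "card T = k - 1 - t"
    by (meson obtain_subset_with_card_n)
  have total: "real t + 1 + real (card T) = real k"
    using t Lk T(2) by simp
  let ?e = "slice_extend n L i j T"
  have "?e x \<in> slice n k" "?e y \<in> slice n k"
    using slice_extend_mem_slice[OF _ i(1) j(1) T(1)] x y sum_x sum_y total by auto
  moreover have "restrict (?e x) I = restrict (?e y) I"
    using i(2) j(2) I(1) xy by (auto simp: slice_extend_def fun_eq_iff restrict_def)
  ultimately have "g (restrict (?e x) {1..L}) = g (restrict (?e y) {1..L})"
    by (metis h)
  with g show False
    using restrict_slice_extend[OF x] restrict_slice_extend[OF y] kn by (metis add_leD2)
qed

theorem lemma3p10:
  fixes d L :: nat and g :: "(nat \<Rightarrow> real) \<Rightarrow> real"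
  assumes "d \<ge> 1"
    and "g \<in> cube L \<rightarrow> {0, 1}"
    and "degree_on L (cube L) g \<le> d"
    and "\<forall>i\<in>{1..L}. cube_depends_on L g i"
  shows "\<forall>n k :: nat. L \<le> k \<and> k + L \<le> n \<longrightarrow>
    (\<exists>f \<in> slice n k \<rightarrow> {0, 1}.
       degree_on n (slice n k) f \<le> d \<and>
       slice_junta n k (int L) f \<and>
       \<not> slice_junta n k (int L - 1) f)"
proof (intro allI impI, elim conjE)
  fix n k :: nat
  assume Lk: "L \<le> k" and kn: "k + L \<le> n"
  then have Ln: "L \<le> n" by simp
  let ?f = "\<lambda>x. g (restrict x {1..L})"
  have "?f \<in> slice n k \<rightarrow> {0, 1}"
    using assms(2) slice_restrict_cube[OF _ Ln] by blast
  moreover have "degree_on n (slice n k) ?f \<le> d"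
    using degree_on_slice_lift[OF Ln] assms(3) by (rule order_trans)
  moreover have "slice_junta n k (int L) ?f"
    unfolding slice_junta_def using assms(2) Ln
    by (intro exI[of _ "{1..L}"] conjI bexI[of _ g]) auto
  moreover have "\<not> slice_junta n k (int L - 1) ?f"
    using assms(4) Lk kn by (rule not_slice_junta_lift)
  ultimately show "\<exists>f \<in> slice n k \<rightarrow> {0, 1}. degree_on n (slice n k) f \<le> d \<and>
      slice_junta n k (int L) f \<and> \<not> slice_junta n k (int L - 1) f"
    by blast
qed

end
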